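(* Let $R$ be a commutative ring, $m\ge1$, let $f_1,\dots,f_m$ be polynomial maps $f_r:R^{d_{r-1}}\to R^{d_r}$, $x\in R^{d_0}$, and $v_1,\dots,v_k\in R^{d_0}$ with $k\ge1$. (1) (Boolean Faà di Bruno) $$D(f_m \circ \cdots \circ f_1;\, x;\, v_1,\dots,v_k) = \sum_{H \in \mathrm{Part}_m([k])} D^H(f_1, \dots, f_m;\, x;\, v_\bullet).$$ (2) (Binomial Faà di Bruno) If $\mathbb{Q}\subseteq R$ and $\gamma\in\mathbb{N}_0^k$, $\gamma\ne0$, then $$D^\gamma(f_m \circ \cdots \circ f_1;\, x;\, v_\bullet) = \sum_{\kappa \in \mathcal{M}_+^m(k)} \mathrm{Part}_m(\gamma, \kappa)\, D^\kappa(f_1, \dots, f_m;\, x;\, v_\bullet),$$ where $\mathrm{Part}_m(\gamma, \kappa) := \#\{H \in \mathrm{Part}_m(S(\gamma)) : \nu(H) = \kappa\}$.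
   Context: Polynomial maps are tuples of formal polynomials. $D(h;a;(w_i)_{i\in I})$ is the coefficient of $\prod_{i\in I}\varepsilon_i$ in $h(a+\sum_{i\in I}\varepsilon_iw_i)$ computed (componentwise) in $R[\varepsilon_i:i\in I]/(\varepsilon_i^2)$. For $B\subseteq[k]$, $v_B=(v_i)_{i\in B}$; for $\alpha\in\mathbb{N}_0^k$, $v_\bullet^{\times\alpha}$ repeats each $v_i$ exactly $\alpha_i$ times and $D^\alpha(h;a;v_\bullet)=D(h;a;v_\bullet^{\times\alpha})$. Put $x_r=(f_r\circ\cdots\circ f_1)(x)$, $x_0=x$. Higher partitions of a nonempty finite set $B$: $\mathrm{Part}(B)$ is the set of partitions of $B$ into nonempty disjoint blocks; $\mathrm{Part}_1(B)=\{B\}$; $\mathrm{Part}_{m+1}(B)=\{\{H_C\}_{C\in\pi}:\pi\in\mathrm{Part}(B),\ H_C\in\mathrm{Part}_m(C)\}$. Iterated differentials along partitions: for $m=1$ and $H=B\in\mathrm{Part}_1(B)$, $B\subseteq[k]$ nonempty, $D^B(f_1;x;v_\bullet)=D(f_1;x;v_B)$; for $m\ge2$ and $H\in\mathrm{Part}_m(B)$, $D^H(f_1,\dots,f_m;x;v_\bullet)=D\big(f_m;x_{m-1};(D^L(f_1,\dots,f_{m-1};x;v_\bullet))_{L\in H}\big)$. Higher multi-indices: $\mathcal{M}_+(A)$ is the set of nonzero finitely supported maps $A\to\mathbb{N}_0$; $\mathcal{M}_+^1(k)=\mathcal{M}_+([k])$, $\mathcal{M}_+^{r}(k)=\mathcal{M}_+(\mathcal{M}_+^{r-1}(k))$.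 For $\alpha\in\mathcal{M}_+^1(k)$, $D^\alpha(f_1;x;v_\bullet)=D(f_1;x;v_\bullet^{\times\alpha})$; for $m\ge2$ and $\kappa\in\mathcal{M}_+^m(k)$, $D^\kappa(f_1,\dots,f_m;x;v_\bullet)=D\big(f_m;x_{m-1};(D^\lambda(f_1,\dots,f_{m-1};x;v_\bullet)^{\times\kappa(\lambda)})_{\kappa(\lambda)>0}\big)$, each $D^\lambda$ appearing $\kappa(\lambda)$ times. Slot set $S(\gamma)=\{(s,i):1\le s\le k,\ 0<i\le\gamma_s\}$. Profile: for nonempty $T\subseteq S(\gamma)$, $\nu(T)_s=\#\{i:(s,i)\in T\}$; for $H$ an $m$-fold partition with $m\ge2$, $\nu(H)(\lambda)=\#\{L\in H:\nu(L)=\lambda\}$. *)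

theory Defs
  imports
    Complex_Main
    "HOL-Library.Poly_Mapping"
    "HOL-Library.Multiset"
    "HOL-Library.FSet"
    "HOL-Library.Disjoint_Sets"
begin

section \<open>Formal polynomials and polynomial maps\<close>

text \<open>
  A formal polynomial with variables indexed by \<open>'i\<close> and coefficients in \<open>'a\<close> is an element of
  the monoid algebra of finitely supported exponent functions.
\<close>

type_synonym ('i, 'a) mpoly = "('i \<Rightarrow>\<^sub>0 nat) \<Rightarrow>\<^sub>0 'a"

definition Const :: "'a::zero \<Rightarrow> ('i, 'a) mpoly" where
  "Const c = Poly_Mapping.single 0 c"

definition Var :: "'i \<Rightarrow> ('i, 'a::comm_ring_1) mpoly" where
  "Var i = Poly_Mapping.single (Poly_Mapping.single i 1) 1"

definition vars :: "('i, 'a::zero) mpoly \<Rightarrow> 'i set" where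
  "vars p = (\<Union>mon \<in> Poly_Mapping.keys p. Poly_Mapping.keys mon)"

text \<open>
  Evaluation of a polynomial over \<open>'a\<close> at a point \<open>y\<close> of a commutative \<open>'a\<close>-algebra \<open>'b\<close> with
  structure map \<open>\<phi>\<close>.
\<close>

definition eval_in :: "('a::zero \<Rightarrow> 'b::comm_ring_1) \<Rightarrow> ('i \<Rightarrow> 'b) \<Rightarrow> ('i, 'a) mpoly \<Rightarrow> 'b" where
  "eval_in \<phi> y p =
    (\<Sum>mon \<in> Poly_Mapping.keys p. \<phi> (Poly_Mapping.lookup p mon) *
       (\<Prod>i \<in> Poly_Mapping.keys mon. y i ^ Poly_Mapping.lookup mon i))"

text \<open>
  Vectors of \<open>R\<^sup>d\<close> are functions on \<open>nat\<close> of which only the coordinates below \<open>d\<close> are relevant;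
  likewise for the tuples of polynomials that make up a polynomial map \<open>R\<^sup>d \<rightarrow> R\<^sup>e\<close>.
\<close>

type_synonym 'a pmap = "nat \<Rightarrow> (nat, 'a) mpoly"

definition is_pmap :: "nat \<Rightarrow> nat \<Rightarrow> 'a::zero pmap \<Rightarrow> bool" where
  "is_pmap d e h \<longleftrightarrow> (\<forall>j<e. vars (h j) \<subseteq> {..<d})"

definition pmap_apply :: "'a::comm_ring_1 pmap \<Rightarrow> (nat \<Rightarrow> 'a) \<Rightarrow> nat \<Rightarrow> 'a" where
  "pmap_apply h x j = eval_in (\<lambda>c. c) x (h j)"

definition pmap_comp :: "'a::comm_ring_1 pmap \<Rightarrow> 'a pmap \<Rightarrow> 'a pmap" where
  "pmap_comp h g j = eval_in Const g (h j)"

text \<open>The composite \<open>f\<^sub>r \<circ> \<dots> \<circ> f\<^sub>1\<close>; it is the identity for \<open>r = 0\<close>.\<close>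

primrec pmap_chain :: "(nat \<Rightarrow> 'a::comm_ring_1 pmap) \<Rightarrow> nat \<Rightarrow> 'a pmap" where
  "pmap_chain f 0 = Var"
| "pmap_chain f (Suc r) = pmap_comp (f (Suc r)) (pmap_chain f r)"


section \<open>The square-zero algebra and polarized differentials\<close>

text \<open>The ideal generated by the squares \<open>\<epsilon>\<^sub>i\<^sup>2\<close> (an ideal is a submodule of the ring over itself).\<close>

definition sq_ideal :: "('i, 'a::comm_ring_1) mpoly set" where
  "sq_ideal = module.span (*) (range (\<lambda>i. Var i ^ 2))"

lemma module_times: "module ((*) :: 'a::comm_ring_1 \<Rightarrow> 'a \<Rightarrow> 'a)"
  by unfold_locales (simp_all add: algebra_simps)

lemma sq_ideal_0: "0 \<in> sq_ideal"
  unfolding sq_ideal_def by (rule module.span_zero[OF module_times])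

lemma sq_ideal_add: "p \<in> sq_ideal \<Longrightarrow> q \<in> sq_ideal \<Longrightarrow> p + q \<in> sq_ideal"
  unfolding sq_ideal_def by (rule module.span_add[OF module_times])

lemma sq_ideal_mult: "p \<in> sq_ideal \<Longrightarrow> c * p \<in> sq_ideal"
  unfolding sq_ideal_def by (rule module.span_scale[OF module_times])

lemma sq_ideal_minus: "p \<in> sq_ideal \<Longrightarrow> - p \<in> sq_ideal"
  using sq_ideal_mult[of p "- 1"] by simp

lemma lookup_mult_Var_sq:
  fixes c :: "('i, 'a::comm_ring_1) mpoly"
  assumes "Poly_Mapping.lookup mon i \<le> 1"
  shows "Poly_Mapping.lookup (c * Var i ^ 2) mon = 0"
proof -
  have sq: "(Var i :: ('i, 'a) mpoly) ^ 2 = Poly_Mapping.single (Poly_Mapping.single i 2) 1"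
    by (simp add: Var_def power2_eq_square mult_single single_add [symmetric] numeral_2_eq_2)
  have "mon \<notin> Poly_Mapping.keys (c * Var i ^ 2)"
  proof
    assume "mon \<in> Poly_Mapping.keys (c * Var i ^ 2)"
    then obtain a where "mon = a + Poly_Mapping.single i 2"
      using keys_mult[of c "Var i ^ 2"] by (auto simp: sq)
    with assms show False by (simp add: lookup_add)
  qed
  then show ?thesis by (simp add: in_keys_iff)
qed

lemma sq_ideal_lookup:
  fixes p :: "('i, 'a::comm_ring_1) mpoly"
  assumes "p \<in> sq_ideal" and sqfree: "\<And>i. Poly_Mapping.lookup mon i \<le> 1"
  shows "Poly_Mapping.lookup p mon = 0"
  using assms(1) unfolding sq_ideal_def
proof (induction p rule: module.span_induct_alt[OF module_times, consumes 1, case_names zero step])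
  case zero
  then show ?case by simp
next
  case (step c b p)
  then obtain i where "b = Var i ^ 2" by blast
  have "Poly_Mapping.lookup (c * b) mon = 0"
    unfolding \<open>b = Var i ^ 2\<close> by (rule lookup_mult_Var_sq) (rule sqfree)
  with step.IH show ?case unfolding lookup_add by (metis add.right_neutral)
qed

lemma diff_add_diff_cancel: "(p - q) + (q - r) = p - (r :: 'b::ab_group_add)"
  by simp

lemma diff_diff_rearrange: "(p - q) - (p' - q') = (p - p') + - (q - (q' :: 'b::ab_group_add))"
  by simp

lemma mult_diff_rearrange: "p * q - p' * q' = p * (q - q') + q' * (p - (p' :: 'b::comm_ring))"
  by (simp add: algebra_simps)

text \<open>
  The algebra \<open>R[\<epsilon>\<^sub>i] / (\<epsilon>\<^sub>i\<^sup>2)\<close> with one \<open>\<epsilon>\<^sub>i\<close> for every \<open>i :: 'i\<close>. For \<open>I \<subseteq> 'i\<close> the algebra with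
  \<open>\<epsilon>\<^sub>i\<close> for \<open>i \<in> I\<close> only is its subalgebra generated by these \<open>\<epsilon>\<^sub>i\<close>.
\<close>

quotient_type (overloaded) ('i, 'a) sqz = "('i, 'a::comm_ring_1) mpoly"
  / "\<lambda>p q. p - q \<in> sq_ideal"
proof (rule equivpI)
  show "reflp (\<lambda>p q :: ('i, 'a) mpoly. p - q \<in> sq_ideal)"
    by (simp add: reflp_def sq_ideal_0)
  show "symp (\<lambda>p q :: ('i, 'a) mpoly. p - q \<in> sq_ideal)"
    by (rule sympI) (drule sq_ideal_minus, simp only: minus_diff_eq)
  show "transp (\<lambda>p q :: ('i, 'a) mpoly. p - q \<in> sq_ideal)"
  proof (rule transpI)
    fix p q r :: "('i, 'a) mpoly"
    assume "p - q \<in> sq_ideal" "q - r \<in> sq_ideal"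
    then have "(p - q) + (q - r) \<in> sq_ideal" by (rule sq_ideal_add)
    then show "p - r \<in> sq_ideal" unfolding diff_add_diff_cancel .
  qed
qed

instantiation sqz :: (type, comm_ring_1) comm_ring_1
begin

lift_definition zero_sqz :: "('a, 'b) sqz" is 0 .

lift_definition one_sqz :: "('a, 'b) sqz" is 1 .

lift_definition plus_sqz :: "('a, 'b) sqz \<Rightarrow> ('a, 'b) sqz \<Rightarrow> ('a, 'b) sqz" is "(+)"
  unfolding add_diff_add by (rule sq_ideal_add)

lift_definition uminus_sqz :: "('a, 'b) sqz \<Rightarrow> ('a, 'b) sqz" is uminus
  unfolding minus_diff_minus by (rule sq_ideal_minus)

lift_definition minus_sqz :: "('a, 'b) sqz \<Rightarrow> ('a, 'b) sqz \<Rightarrow> ('a, 'b) sqz" is "(-)"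
proof -
  fix p p' q q' :: "('a, 'b) mpoly"
  assume "p - p' \<in> sq_ideal" "q - q' \<in> sq_ideal"
  then have "(p - p') + - (q - q') \<in> sq_ideal"
    by (intro sq_ideal_add sq_ideal_minus)
  then show "(p - q) - (p' - q') \<in> sq_ideal"
    by (simp only: diff_diff_rearrange)
qed

lift_definition times_sqz :: "('a, 'b) sqz \<Rightarrow> ('a, 'b) sqz \<Rightarrow> ('a, 'b) sqz" is "(*)"
proof -
  fix p p' q q' :: "('a, 'b) mpoly"
  assume "p - p' \<in> sq_ideal" "q - q' \<in> sq_ideal"
  then have "p * (q - q') + q' * (p - p') \<in> sq_ideal"
    by (intro sq_ideal_add sq_ideal_mult)
  then show "p * q - p' * q' \<in> sq_ideal"
    by (simp only: mult_diff_rearrange)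
qed

instance
proof
  have "0 - 1 \<notin> (sq_ideal :: ('a, 'b) mpoly set)"
  proof
    assume "0 - 1 \<in> (sq_ideal :: ('a, 'b) mpoly set)"
    then have "Poly_Mapping.lookup (0 - 1 :: ('a, 'b) mpoly) 0 = 0"
      by (rule sq_ideal_lookup) simp
    then show False by (simp add: lookup_minus lookup_one)
  qed
  then show "(0 :: ('a, 'b) sqz) \<noteq> 1"
    by transfer
  fix p q r :: "('a, 'b) sqz"
  show "p + q + r = p + (q + r)" by transfer (simp add: add.assoc sq_ideal_0)
  show "p + q = q + p" by transfer (simp add: add.commute sq_ideal_0)
  show "0 + p = p" by transfer (simp add: sq_ideal_0)
  show "- p + p = 0" by transfer (simp add: sq_ideal_0)
  show "p - q = p + - q" by transfer (simp add: sq_ideal_0)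
  show "p * q * r = p * (q * r)" by transfer (simp add: mult.assoc sq_ideal_0)
  show "p * q = q * p" by transfer (simp add: mult.commute sq_ideal_0)
  show "1 * p = p" by transfer (simp add: sq_ideal_0)
  show "(p + q) * r = p * r + q * r" by transfer (simp add: distrib_right sq_ideal_0)
qed

end

lift_definition sqz_const :: "'a::comm_ring_1 \<Rightarrow> ('i, 'a) sqz" is Const .

lift_definition sqz_eps :: "'i \<Rightarrow> ('i, 'a::comm_ring_1) sqz" is Var .

text \<open>
  The coefficient of \<open>\<Prod>i\<in>I. \<epsilon>\<^sub>i\<close>. Elements of the ideal have no square-free monomials, so that this
  is well defined on the quotient.
\<close>

lift_definition sqz_coeff :: "'i set \<Rightarrow> ('i, 'a::comm_ring_1) sqz \<Rightarrow> 'a" is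
  "\<lambda>I p. Poly_Mapping.lookup p (\<Sum>i\<in>I. Poly_Mapping.single i 1)"
proof -
  fix I :: "'i set" and p q :: "('i, 'a) mpoly"
  assume *: "p - q \<in> sq_ideal"
  have "Poly_Mapping.lookup (\<Sum>j\<in>I. Poly_Mapping.single j (1::nat)) i \<le> 1" for i
    by (cases "finite I") (simp_all add: lookup_sum lookup_single when_def)
  from sq_ideal_lookup[OF * this]
  show "Poly_Mapping.lookup p (\<Sum>i\<in>I. Poly_Mapping.single i 1) =
      Poly_Mapping.lookup q (\<Sum>i\<in>I. Poly_Mapping.single i 1)"
    by (simp add: lookup_minus)
qed

text \<open>\<open>D(h; a; (w\<^sub>i)\<^sub>i\<^sub>\<in>\<^sub>I)\<close> for finite \<open>I\<close>, componentwise.\<close>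

definition D ::
  "'a::comm_ring_1 pmap \<Rightarrow> (nat \<Rightarrow> 'a) \<Rightarrow> 'i set \<Rightarrow> ('i \<Rightarrow> nat \<Rightarrow> 'a) \<Rightarrow> nat \<Rightarrow> 'a" where
  "D h a I w j =
    sqz_coeff I (eval_in sqz_const
      (\<lambda>l. sqz_const (a l) + (\<Sum>i\<in>I. sqz_eps i * sqz_const (w i l))) (h j))"

text \<open>
  A multi-index is a multiset \<open>\<alpha>\<close>, seen as the finitely supported function \<open>count \<alpha>\<close>. A family in
  which each \<open>w s\<close> is repeated \<open>count \<alpha> s\<close> times is indexed by the slots of \<open>\<alpha>\<close>.
\<close>

definition slots :: "'s multiset \<Rightarrow> ('s \<times> nat) set" where
  "slots \<alpha> = {(s, i). 0 < i \<and> i \<le> count \<alpha> s}"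

definition D_rep ::
  "'a::comm_ring_1 pmap \<Rightarrow> (nat \<Rightarrow> 'a) \<Rightarrow> 's multiset \<Rightarrow> ('s \<Rightarrow> nat \<Rightarrow> 'a) \<Rightarrow> nat \<Rightarrow> 'a" where
  "D_rep h a \<alpha> w = D h a (slots \<alpha>) (\<lambda>(s, i). w s)"


section \<open>Higher partitions\<close>

text \<open>
  As the type of an \<open>m\<close>-fold partition depends on \<open>m\<close>, all levels are put into one datatype. An
  element of \<open>Part\<^sub>1(B)\<close> is \<open>Block B\<close>, and \<open>Family H\<close> is the finite set \<open>H\<close> of partitions one level
  below.
\<close>

datatype 'b hpart = Block "'b set" | Family "'b hpart fset"

fun hparts :: "nat \<Rightarrow> 'b set \<Rightarrow> 'b hpart set" where
  "hparts 0 B = {}"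
| "hparts (Suc 0) B = {Block B}"
| "hparts (Suc (Suc r)) B =
    {Family H | H. \<exists>\<pi> h. partition_on B \<pi> \<and> (\<forall>C\<in>\<pi>. h C \<in> hparts (Suc r) C) \<and> fset H = h ` \<pi>}"

text \<open>
  \<open>D_hpart f x v m H\<close> is \<open>D\<^sup>H(f\<^sub>1, \<dots>, f\<^sub>m; x; v)\<close>; arguments for which \<open>H\<close> is not an \<open>m\<close>-fold partition
  are irrelevant.
\<close>

fun D_hpart ::
  "(nat \<Rightarrow> 'a::comm_ring_1 pmap) \<Rightarrow> (nat \<Rightarrow> 'a) \<Rightarrow> ('b \<Rightarrow> nat \<Rightarrow> 'a) \<Rightarrow> nat \<Rightarrow> 'b hpart \<Rightarrow> nat \<Rightarrow> 'a"
where
  "D_hpart f x v (Suc 0) (Block B) = D (f 1) x B v"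
| "D_hpart f x v (Suc (Suc r)) (Family H) =
    D (f (Suc (Suc r))) (pmap_apply (pmap_chain f (Suc r)) x) (fset H) (D_hpart f x v (Suc r))"
| "D_hpart f x v _ _ = undefined"


section \<open>Higher multi-indices\<close>

text \<open>
  Here too all levels are put into one datatype: \<open>Index\<close> for level 1 and \<open>Higher\<close> for finitely
  supported functions on the multi-indices one level below.
\<close>

datatype hindex = Index "nat multiset" | Higher "hindex multiset"

fun hindices :: "nat \<Rightarrow> nat \<Rightarrow> hindex set" where
  "hindices 0 k = {}"
| "hindices (Suc 0) k = {Index \<alpha> | \<alpha>. \<alpha> \<noteq> {#} \<and> set_mset \<alpha> \<subseteq> {1..k}}"
| "hindices (Suc (Suc r)) k = {Higher \<kappa> | \<kappa>. \<kappa> \<noteq> {#} \<and> set_mset \<kappa> \<subseteq> hindices (Suc r) k}"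

fun D_hindex ::
  "(nat \<Rightarrow> 'a::comm_ring_1 pmap) \<Rightarrow> (nat \<Rightarrow> 'a) \<Rightarrow> (nat \<Rightarrow> nat \<Rightarrow> 'a) \<Rightarrow> nat \<Rightarrow> hindex \<Rightarrow> nat \<Rightarrow> 'a"
where
  "D_hindex f x v (Suc 0) (Index \<alpha>) = D_rep (f 1) x \<alpha> v"
| "D_hindex f x v (Suc (Suc r)) (Higher \<kappa>) =
    D_rep (f (Suc (Suc r))) (pmap_apply (pmap_chain f (Suc r)) x) \<kappa> (D_hindex f x v (Suc r))"
| "D_hindex f x v _ _ = undefined"

text \<open>
  The profile of a higher partition of a slot set; the two lemmas after the definition give its
  multiplicities.
\<close>

context
  notes image_mset_cong [fundef_cong]
begin

function profile :: "(nat \<times> nat) hpart \<Rightarrow> hindex" where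
  "profile (Block T) = Index (image_mset fst (mset_set T))"
| "profile (Family H) = Higher (image_mset profile (mset_set (fset H)))"
  by pat_completeness auto

termination
proof (relation "measure size")
  fix H :: "(nat \<times> nat) hpart fset" and L
  assume "L \<in># mset_set (fset H)"
  then have "L \<in> fset H" by simp
  then have "Suc (size L) \<le> (\<Sum>M\<in>fset H. Suc (size M))"
    by (intro member_le_sum) simp_all
  then show "(L, Family H) \<in> measure size" by simp
qed simp

end

lemma count_image_mset_set:
  "finite A \<Longrightarrow> count (image_mset g (mset_set A)) y = card {a \<in> A. g a = y}"
proof (induction A rule: finite_induct)
  case (insert x F)
  have "{a \<in> insert x F. g a = y} =
      (if g x = y then insert x {a \<in> F. g a = y} else {a \<in> F. g a = y})"
    by auto
  with insert show ?case by simp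
qed simp

lemma profile_Block:
  assumes "finite T"
  shows "\<exists>\<alpha>. profile (Block T) = Index \<alpha> \<and> (\<forall>s. count \<alpha> s = card {i. (s, i) \<in> T})"
proof -
  have "{a \<in> T. fst a = s} = Pair s ` {i. (s, i) \<in> T}" for s
    by auto
  then have "card {a \<in> T. fst a = s} = card {i. (s, i) \<in> T}" for s
    by (simp add: card_image inj_on_def)
  then show ?thesis using assms by (simp add: count_image_mset_set)
qed

lemma profile_Family:
  "\<exists>\<kappa>. profile (Family H) = Higher \<kappa> \<and> (\<forall>\<mu>. count \<kappa> \<mu> = card {L \<in> fset H. profile L = \<mu>})"
  by (simp add: count_image_mset_set)

definition Part_count :: "nat \<Rightarrow> nat multiset \<Rightarrow> hindex \<Rightarrow> nat" where
  "Part_count m \<gamma> \<kappa> = card {H \<in> hparts m (slots \<gamma>). profile H = \<kappa>}"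


section \<open>Rings containing the rational numbers\<close>

definition contains_rat :: "'a::comm_ring_1 itself \<Rightarrow> bool" where
  "contains_rat _ \<longleftrightarrow> (\<exists>\<phi> :: rat \<Rightarrow> 'a. inj \<phi> \<and> \<phi> 1 = 1 \<and>
     (\<forall>a b. \<phi> (a + b) = \<phi> a + \<phi> b) \<and> (\<forall>a b. \<phi> (a * b) = \<phi> a * \<phi> b))"

end

theory Submission
  imports Defs
begin

text \<open>
  In the square-zero algebra a product of square-free monomials survives only if the sets of
  variables are disjoint. Hence the coefficient of \<open>\<Prod>i\<in>I. \<epsilon>\<^sub>i\<close> obeys a Leibniz rule: that of \<open>p q\<close>
  is the sum, over the subsets \<open>S\<close> of \<open>I\<close>, of the coefficient of \<open>p\<close> at \<open>S\<close> times that of \<open>q\<close> at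
  \<open>I - S\<close> (\<open>polar_mult\<close>). Together with additivity and the values on constants and variables this
  rule determines the polarized differentials of all polynomials.

  The first formula reduces to the composite of two maps. Call a set of structures an assembly on
  \<open>B\<close> if their supports form a partition of \<open>B\<close>. If the differentials of \<open>G\<close> along each nonempty \<open>C\<close>
  are sums of terms \<open>u L\<close> over structures \<open>L\<close> with support \<open>C\<close>, then the differential of \<open>F \<circ> G\<close>
  along \<open>B\<close> is the sum, over the assemblies \<open>H\<close> on \<open>B\<close>, of the differentials of \<open>F\<close> in the directions
  \<open>u L\<close>, \<open>L \<in> H\<close> (\<open>polar_compose\<close>). By the Leibniz rule it suffices that splitting an
  assembly in two amounts to splitting \<open>B\<close> in two and choosing an assembly on each part. The
  \<open>(m + 1)\<close>-fold partitions are exactly the assemblies of \<open>m\<close>-fold partitions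
  (\<open>hparts_Suc_Suc_eq_assemblies\<close>), so induction on \<open>m\<close> gives the first formula over any finite
  nonempty set.

  The second formula is the first one over the slot set of \<open>\<gamma>\<close>. A direction depends on its slot
  only through the first component, so the term of a higher partition depends only on its profile
  (\<open>D_hpart_eq_D_hindex\<close>), and collecting terms of equal profile produces the multiplicities
  \<open>Part_count\<close>.
\<close>

section \<open>Polynomial algebra\<close>

lemma sum_single_lookup:
  fixes p :: "'k \<Rightarrow>\<^sub>0 'a::comm_monoid_add"
  shows "(\<Sum>k\<in>Poly_Mapping.keys p. Poly_Mapping.single k (Poly_Mapping.lookup p k)) = p"
  by (rule poly_mapping_eqI) (auto simp: lookup_sum lookup_single when_def in_keys_iff)

lemma poly_mapping_additive_induct [case_names single add]:
  fixes p :: "'k \<Rightarrow>\<^sub>0 'a::comm_monoid_add"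
  assumes single: "\<And>k c. P (Poly_Mapping.single k c)"
    and add: "\<And>p q. P p \<Longrightarrow> P q \<Longrightarrow> P (p + q)"
  shows "P p"
proof -
  have "P (\<Sum>k\<in>K. Poly_Mapping.single k (Poly_Mapping.lookup p k))" if "finite K" for K
    using that
  proof (induction K rule: finite_induct)
    case empty
    show ?case using single[of undefined 0] by simp
  next
    case (insert k K)
    then show ?case by (simp add: add single)
  qed
  from this[OF finite_keys[of p]] show ?thesis by (simp only: sum_single_lookup)
qed

text \<open>
  Every functional below is determined by its behaviour on constants, variables, sums and products,
  so that identities between them are proved by this induction.
\<close>

lemma mpoly_induct [case_names Const Var add mult]:
  fixes p :: "('i, 'a::comm_ring_1) mpoly"
  assumes Const: "\<And>c. P (Const c)" and Var: "\<And>i. P (Var i)"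
    and add: "\<And>p q. P p \<Longrightarrow> P q \<Longrightarrow> P (p + q)"
    and mult: "\<And>p q. P p \<Longrightarrow> P q \<Longrightarrow> P (p * q)"
  shows "P p"
proof (induction p rule: poly_mapping_additive_induct)
  case (single mon c)
  show ?case
  proof (induction mon arbitrary: c rule: poly_mapping_additive_induct)
    case (single i n)
    show ?case
    proof (induction n)
      case 0
      show ?case using Const[of c] by (simp add: Const_def)
    next
      case (Suc n)
      have "Poly_Mapping.single (Poly_Mapping.single i (Suc n)) c =
          Poly_Mapping.single (Poly_Mapping.single i n) c * Var i"
        by (simp add: Var_def mult_single single_add [symmetric])
      with mult[OF Suc Var] show ?case by simp
    qed
  next
    case (add a b)
    have "Poly_Mapping.single (a + b) c = Poly_Mapping.single a c * Poly_Mapping.single b 1"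
      by (simp add: mult_single)
    with mult[OF add] show ?case by simp
  qed
qed (rule add)

locale unital_ring_hom =
  fixes \<phi> :: "'a::comm_ring_1 \<Rightarrow> 'b::comm_ring_1"
  assumes one: "\<phi> 1 = 1"
    and plus: "\<phi> (a + b) = \<phi> a + \<phi> b"
    and times: "\<phi> (a * b) = \<phi> a * \<phi> b"
begin

lemma zero: "\<phi> 0 = 0"
  using plus[of 0 0] by simp

lemma eval_in_superset:
  assumes "finite K" "Poly_Mapping.keys p \<subseteq> K"
  shows "eval_in \<phi> y p = (\<Sum>mon\<in>K. \<phi> (Poly_Mapping.lookup p mon) *
    (\<Prod>i\<in>Poly_Mapping.keys mon. y i ^ Poly_Mapping.lookup mon i))"
  unfolding eval_in_def
  by (rule sum.mono_neutral_left) (use assms zero in \<open>auto simp: in_keys_iff\<close>)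

lemma eval_in_single:
  "eval_in \<phi> y (Poly_Mapping.single mon c) =
    \<phi> c * (\<Prod>i\<in>Poly_Mapping.keys mon. y i ^ Poly_Mapping.lookup mon i)"
  by (subst eval_in_superset[of "{mon}"]) auto

lemma eval_in_Const: "eval_in \<phi> y (Const c) = \<phi> c"
  unfolding Const_def by (simp add: eval_in_single)

lemma eval_in_Var: "eval_in \<phi> y (Var i) = y i"
  unfolding Var_def by (simp add: eval_in_single one)

lemma eval_in_add: "eval_in \<phi> y (p + q) = eval_in \<phi> y p + eval_in \<phi> y q"
proof -
  let ?K = "Poly_Mapping.keys p \<union> Poly_Mapping.keys q"
  show ?thesis
    using keys_add[of p q]
    by (subst (1 2 3) eval_in_superset[of ?K])
       (auto simp: lookup_add plus distrib_right sum.distrib)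
qed

lemma monomial_value_superset:
  fixes y :: "'i \<Rightarrow> 'b"
  assumes "finite K" "Poly_Mapping.keys mon \<subseteq> K"
  shows "(\<Prod>i\<in>Poly_Mapping.keys mon. y i ^ Poly_Mapping.lookup mon i) =
    (\<Prod>i\<in>K. y i ^ Poly_Mapping.lookup mon i)"
  by (rule prod.mono_neutral_left) (use assms in \<open>auto simp: in_keys_iff\<close>)

lemma monomial_value_add:
  fixes y :: "'i \<Rightarrow> 'b"
  shows "(\<Prod>i\<in>Poly_Mapping.keys (a + b). y i ^ Poly_Mapping.lookup (a + b) i) =
    (\<Prod>i\<in>Poly_Mapping.keys a. y i ^ Poly_Mapping.lookup a i) *
    (\<Prod>i\<in>Poly_Mapping.keys b. y i ^ Poly_Mapping.lookup b i)"
proof -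
  let ?K = "Poly_Mapping.keys a \<union> Poly_Mapping.keys b"
  show ?thesis
    using keys_add[of a b]
    by (subst (1 2 3) monomial_value_superset[of ?K])
       (auto simp: lookup_add power_add prod.distrib)
qed

lemma eval_in_mult: "eval_in \<phi> y (p * q) = eval_in \<phi> y p * eval_in \<phi> y q"
proof (induction p rule: poly_mapping_additive_induct)
  case (single a c)
  show ?case
  proof (induction q rule: poly_mapping_additive_induct)
    case (single b e)
    show ?case
      by (simp add: mult_single eval_in_single monomial_value_add times mult_ac)
  qed (simp add: distrib_left eval_in_add)
qed (simp add: distrib_right eval_in_add)

end

interpretation id_hom: unital_ring_hom "\<lambda>c :: 'a::comm_ring_1. c"
  by unfold_locales auto

interpretation Const_hom: unital_ring_hom "Const :: 'a::comm_ring_1 \<Rightarrow> ('i, 'a) mpoly"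
  by unfold_locales (simp_all add: Const_def single_add mult_single)

interpretation sqz_const_hom: unital_ring_hom "sqz_const :: 'a::comm_ring_1 \<Rightarrow> ('i, 'a) sqz"
  by (unfold_locales; transfer)
     (simp_all add: Const_hom.one Const_hom.plus Const_hom.times sq_ideal_0)

lemma eval_in_Const_Var: "eval_in Const Var p = p"
  by (induction p rule: mpoly_induct)
     (simp_all add: Const_hom.eval_in_Const Const_hom.eval_in_Var
       Const_hom.eval_in_add Const_hom.eval_in_mult)


section \<open>Coefficients in the square-zero algebra\<close>

definition sqfree_mon :: "'i set \<Rightarrow> 'i \<Rightarrow>\<^sub>0 nat" where
  "sqfree_mon I = (\<Sum>i\<in>I. Poly_Mapping.single i 1)"

lemma lookup_sqfree_mon:
  "finite I \<Longrightarrow> Poly_Mapping.lookup (sqfree_mon I) i = (if i \<in> I then 1 else 0)"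
  by (simp add: sqfree_mon_def lookup_sum lookup_single when_def)

lemma sqfree_mon_eq_iff:
  assumes "finite I"
  shows "mon = sqfree_mon I \<longleftrightarrow> (\<forall>i. Poly_Mapping.lookup mon i = (if i \<in> I then 1 else 0))"
  using assms by (auto simp: lookup_sqfree_mon intro: poly_mapping_eqI)

text \<open>
  A square-free monomial factors into two monomials exactly by splitting its set of variables; this
  is the source of every product rule below.
\<close>

lemma sqfree_mon_eq_add_iff:
  assumes "finite I" "S \<subseteq> I"
  shows "(a = sqfree_mon S \<and> b = sqfree_mon (I - S)) \<longleftrightarrow>
    a + b = sqfree_mon I \<and> S = Poly_Mapping.keys a"
proof -
  have fin: "finite S" "finite (I - S)"
    using assms by (auto intro: finite_subset)
  show ?thesis
  proof
    assume "a = sqfree_mon S \<and> b = sqfree_mon (I - S)"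
    then have "\<And>i. Poly_Mapping.lookup a i = (if i \<in> S then 1 else 0)"
        "\<And>i. Poly_Mapping.lookup b i = (if i \<in> I - S then 1 else 0)"
      using fin by (simp_all add: lookup_sqfree_mon)
    then show "a + b = sqfree_mon I \<and> S = Poly_Mapping.keys a"
      using assms by (auto simp: sqfree_mon_eq_iff lookup_add in_keys_iff split: if_splits)
  next
    assume ab: "a + b = sqfree_mon I \<and> S = Poly_Mapping.keys a"
    then have sum: "Poly_Mapping.lookup a i + Poly_Mapping.lookup b i = (if i \<in> I then 1 else 0)" for i
      using assms(1) by (simp add: lookup_add [symmetric] lookup_sqfree_mon)
    have "i \<in> S \<longleftrightarrow> Poly_Mapping.lookup a i \<noteq> 0" for i
      using ab by (simp add: in_keys_iff)
    then have "Poly_Mapping.lookup a i = (if i \<in> S then 1 else 0)"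
        "Poly_Mapping.lookup b i = (if i \<in> I - S then 1 else 0)" for i
      using sum[of i] subsetD[OF assms(2), of i] by (auto split: if_splits)
    then show "a = sqfree_mon S \<and> b = sqfree_mon (I - S)"
      using fin by (simp add: sqfree_mon_eq_iff)
  qed
qed

lemma lookup_mult_sqfree_mon:
  fixes p q :: "('i, 'a::comm_ring_1) mpoly"
  assumes I: "finite I"
  shows "Poly_Mapping.lookup (p * q) (sqfree_mon I) =
    (\<Sum>S\<in>Pow I. Poly_Mapping.lookup p (sqfree_mon S) * Poly_Mapping.lookup q (sqfree_mon (I - S)))"
proof (induction p rule: poly_mapping_additive_induct)
  case (single a c)
  show ?case
  proof (induction q rule: poly_mapping_additive_induct)
    case (single b e)
    have "(\<Sum>S\<in>Pow I. Poly_Mapping.lookup (Poly_Mapping.single a c) (sqfree_mon S) *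
          Poly_Mapping.lookup (Poly_Mapping.single b e) (sqfree_mon (I - S))) =
        (\<Sum>S\<in>Pow I. if a = sqfree_mon S \<and> b = sqfree_mon (I - S) then c * e else 0)"
      by (intro sum.cong refl) (auto simp: lookup_single when_def)
    also have "\<dots> = (\<Sum>S\<in>Pow I. if S = Poly_Mapping.keys a then
        (if a + b = sqfree_mon I then c * e else 0) else 0)"
      by (intro sum.cong refl) (use I in \<open>simp add: sqfree_mon_eq_add_iff\<close>)
    also have "\<dots> = (if a + b = sqfree_mon I then c * e else 0)"
    proof -
      have "Poly_Mapping.keys a \<subseteq> I" if "a + b = sqfree_mon I"
      proof
        fix i assume "i \<in> Poly_Mapping.keys a"
        moreover have "Poly_Mapping.lookup a i + Poly_Mapping.lookup b i = (if i \<in> I then 1 else 0)"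
          using that I by (simp add: lookup_add [symmetric] lookup_sqfree_mon)
        ultimately show "i \<in> I" by (auto simp: in_keys_iff split: if_splits)
      qed
      then show ?thesis using I by (simp add: sum.delta)
    qed
    finally show ?case by (simp add: mult_single lookup_single when_def)
  qed (simp add: distrib_left lookup_add sum.distrib)
qed (simp add: distrib_right lookup_add sum.distrib)

lemma sqz_coeff_mult:
  assumes "finite I"
  shows "sqz_coeff I (p * q) = (\<Sum>S\<in>Pow I. sqz_coeff S p * sqz_coeff (I - S) q)"
  by (transfer fixing: I) (use assms lookup_mult_sqfree_mon in \<open>simp add: sqfree_mon_def\<close>)

lemma sqz_coeff_add: "sqz_coeff I (p + q) = sqz_coeff I p + sqz_coeff I q"
  by transfer (simp add: lookup_add)

lemma sqz_coeff_zero: "sqz_coeff I 0 = 0"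
  by transfer simp

lemma sqz_coeff_sum: "sqz_coeff I (\<Sum>j\<in>J. g j) = (\<Sum>j\<in>J. sqz_coeff I (g j))"
  by (induction J rule: infinite_finite_induct) (simp_all add: sqz_coeff_add sqz_coeff_zero)

lemma sqz_coeff_const:
  assumes "finite I"
  shows "sqz_coeff I (sqz_const c) = (if I = {} then c else 0)"
proof -
  have "0 = sqfree_mon I \<longleftrightarrow> I = {}"
    using assms by (auto simp: sqfree_mon_eq_iff)
  then show ?thesis
    by (transfer fixing: I) (auto simp: Const_def lookup_single when_def sqfree_mon_def)
qed

lemma sqz_coeff_eps_const:
  assumes "finite I"
  shows "sqz_coeff I (sqz_eps i * sqz_const c) = (if I = {i} then c else 0)"
proof -
  have "Poly_Mapping.single i 1 = sqfree_mon I \<longleftrightarrow> I = {i}"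
    using assms by (auto simp: sqfree_mon_eq_iff lookup_single when_def split: if_splits)
  then show ?thesis
    by (transfer fixing: I i)
      (auto simp: Var_def Const_def mult_single lookup_single when_def sqfree_mon_def)
qed



section \<open>Polarized differentials of a single polynomial\<close>

text \<open>The polarized differential of one component of a polynomial map.\<close>

definition polar ::
  "(nat \<Rightarrow> 'a::comm_ring_1) \<Rightarrow> ('i \<Rightarrow> nat \<Rightarrow> 'a) \<Rightarrow> 'i set \<Rightarrow> (nat, 'a) mpoly \<Rightarrow> 'a" where
  "polar a w I p =
    sqz_coeff I (eval_in sqz_const
      (\<lambda>l. sqz_const (a l) + (\<Sum>i\<in>I. sqz_eps i * sqz_const (w i l))) p)"

lemma D_eq_polar: "D h a I w j = polar a w I (h j)"
  by (simp add: D_def polar_def)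

lemma sqz_coeff_perturbed_Var:
  assumes "finite I" "S \<subseteq> I"
  shows "sqz_coeff S (sqz_const (a l) + (\<Sum>i\<in>I. sqz_eps i * sqz_const (w i l))) =
    (if S = {} then a l else 0) + (\<Sum>i\<in>S. if S = {i} then w i l else 0)"
proof -
  have "finite S" using assms by (rule finite_subset [rotated])
  moreover have "(\<Sum>i\<in>I. if S = {i} then w i l else 0) = (\<Sum>i\<in>S. if S = {i} then w i l else 0)"
    by (rule sum.mono_neutral_right) (use assms in auto)
  ultimately show ?thesis
    by (simp add: sqz_coeff_add sqz_coeff_sum sqz_coeff_const sqz_coeff_eps_const)
qed

text \<open>
  The coefficient at \<open>S\<close> ignores the perturbations in directions outside \<open>S\<close>, because every factor
  of a product then contributes a coefficient at a subset of \<open>S\<close>.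
\<close>

lemma sqz_coeff_perturbed:
  assumes "finite I" "S \<subseteq> I"
  shows "sqz_coeff S (eval_in sqz_const
    (\<lambda>l. sqz_const (a l) + (\<Sum>i\<in>I. sqz_eps i * sqz_const (w i l))) p) = polar a w S p"
  using assms
proof (induction p arbitrary: S I rule: mpoly_induct)
  case (Const c)
  then show ?case by (simp add: polar_def sqz_const_hom.eval_in_Const)
next
  case (Var i)
  then have "finite S" by (auto intro: finite_subset)
  with Var show ?case
    by (simp add: polar_def sqz_const_hom.eval_in_Var sqz_coeff_perturbed_Var)
next
  case (add p q)
  then show ?case by (simp add: polar_def sqz_const_hom.eval_in_add sqz_coeff_add)
next
  case (mult p q)
  then have S: "finite S" by (auto intro: finite_subset)
  have "sqz_coeff S (eval_in sqz_const
      (\<lambda>l. sqz_const (a l) + (\<Sum>i\<in>J. sqz_eps i * sqz_const (w i l))) (p * q)) =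
      (\<Sum>T\<in>Pow S. polar a w T p * polar a w (S - T) q)" if "finite J" "S \<subseteq> J" for J
    unfolding sqz_const_hom.eval_in_mult sqz_coeff_mult[OF S]
    by (intro sum.cong refl arg_cong2[where f = "(*)"] mult.IH) (use that in auto)
  from this[OF mult.prems] this[OF S] show ?case by (simp add: polar_def)
qed

lemma polar_Const: "finite I \<Longrightarrow> polar a w I (Const c) = (if I = {} then c else 0)"
  by (simp add: polar_def sqz_const_hom.eval_in_Const sqz_coeff_const)

lemma polar_Var:
  "finite I \<Longrightarrow> polar a w I (Var l) =
    (if I = {} then a l else 0) + (\<Sum>i\<in>I. if I = {i} then w i l else 0)"
  by (simp add: polar_def sqz_const_hom.eval_in_Var sqz_coeff_perturbed_Var)

lemma polar_add: "polar a w I (p + q) = polar a w I p + polar a w I q"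
  by (simp add: polar_def sqz_const_hom.eval_in_add sqz_coeff_add)

lemma polar_mult:
  assumes "finite I"
  shows "polar a w I (p * q) = (\<Sum>S\<in>Pow I. polar a w S p * polar a w (I - S) q)"
proof -
  have "polar a w I (p * q) = (\<Sum>S\<in>Pow I.
      sqz_coeff S (eval_in sqz_const
        (\<lambda>l. sqz_const (a l) + (\<Sum>i\<in>I. sqz_eps i * sqz_const (w i l))) p) *
      sqz_coeff (I - S) (eval_in sqz_const
        (\<lambda>l. sqz_const (a l) + (\<Sum>i\<in>I. sqz_eps i * sqz_const (w i l))) q))"
    by (simp add: polar_def sqz_const_hom.eval_in_mult sqz_coeff_mult assms)
  also have "\<dots> = (\<Sum>S\<in>Pow I. polar a w S p * polar a w (I - S) q)"
    by (intro sum.cong refl) (use assms in \<open>auto simp: sqz_coeff_perturbed\<close>)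
  finally show ?thesis .
qed

lemma polar_empty: "polar a w {} p = eval_in (\<lambda>c. c) a p"
  by (induction p rule: mpoly_induct)
     (simp_all add: polar_Const polar_Var polar_add polar_mult id_hom.eval_in_Const
       id_hom.eval_in_Var id_hom.eval_in_add id_hom.eval_in_mult)

text \<open>
  Differentials depend on the family of directions only, not on its indexing: a repeated direction
  may be indexed by any set of the right size.
\<close>

lemma polar_reindex:
  assumes "finite I" "inj_on g I" "\<And>i. i \<in> I \<Longrightarrow> w i = w' (g i)"
  shows "polar a w' (g ` I) p = polar a w I p"
  using assms
proof (induction p arbitrary: I rule: mpoly_induct)
  case (Const c)
  then show ?case by (simp add: polar_Const)
next
  case (Var l)
  have "(\<Sum>i\<in>g ` I. if g ` I = {i} then w' i l else 0) = (\<Sum>i\<in>I. if g ` I = {g i} then w' (g i) l else 0)"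
    using Var by (simp add: sum.reindex)
  also have "\<dots> = (\<Sum>i\<in>I. if I = {i} then w i l else 0)"
  proof (rule sum.cong [OF refl])
    fix i assume i: "i \<in> I"
    have "g ` I = {g i} \<longleftrightarrow> I = {i}"
      using inj_on_image_eq_iff[OF Var(2), of I "{i}"] i by simp
    with Var(3)[OF i] show "(if g ` I = {g i} then w' (g i) l else 0) = (if I = {i} then w i l else 0)"
      by simp
  qed
  finally show ?case using Var by (simp add: polar_Var)
next
  case (add p q)
  then show ?case by (simp add: polar_add)
next
  case (mult p q)
  have Pow: "Pow (g ` I) = (`) g ` Pow I"
    by (simp add: image_Pow_surj)
  have "polar a w' (g ` I) (p * q) =
      (\<Sum>S\<in>Pow I. polar a w' (g ` S) p * polar a w' (g ` I - g ` S) q)"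
    unfolding polar_mult[OF finite_imageI[OF mult.prems(1)]] Pow
    by (subst sum.reindex) (use inj_on_image_Pow[OF mult.prems(2)] in simp_all)
  also have "\<dots> = (\<Sum>S\<in>Pow I. polar a w S p * polar a w (I - S) q)"
  proof (intro sum.cong refl)
    fix S assume "S \<in> Pow I"
    then have S: "S \<subseteq> I" by simp
    have "polar a w' (g ` S) p = polar a w S p"
      by (rule mult.IH(1)) (use S mult.prems in \<open>auto intro: finite_subset inj_on_subset\<close>)
    moreover have "polar a w' (g ` (I - S)) q = polar a w (I - S) q"
      by (rule mult.IH(2)) (use S mult.prems in \<open>auto intro: finite_subset inj_on_subset\<close>)
    moreover have "g ` I - g ` S = g ` (I - S)"
      using S mult.prems(2) by (simp add: inj_on_image_set_diff)
    ultimately show "polar a w' (g ` S) p * polar a w' (g ` I - g ` S) q =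
        polar a w S p * polar a w (I - S) q" by simp
  qed
  finally show ?case by (simp add: polar_mult mult.prems(1))
qed


section \<open>Assemblies and the chain rule\<close>

text \<open>
  If \<open>P C\<close> is the set of structures of some kind on \<open>C\<close> and \<open>\<sigma>\<close> recovers \<open>C\<close> from such a structure,
  then these are the assemblies of \<open>P\<close>-structures on \<open>B\<close> in the sense of combinatorial species: a
  partition of \<open>B\<close> into nonempty blocks together with a \<open>P\<close>-structure on each block. The partition
  is not a separate component, because it can be read off from the structures.
\<close>

definition assemblies :: "('c \<Rightarrow> 'b set) \<Rightarrow> ('b set \<Rightarrow> 'c set) \<Rightarrow> 'b set \<Rightarrow> 'c set set" where
  "assemblies \<sigma> P B = {H. (\<forall>L\<in>H. \<sigma> L \<noteq> {} \<and> L \<in> P (\<sigma> L)) \<and> disjoint_family_on \<sigma> H \<and> \<Union> (\<sigma> ` H) = B}"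

lemma assemblies_subset_Pow: "assemblies \<sigma> P B \<subseteq> Pow (\<Union>C\<in>Pow B. P C)"
proof (intro subsetI PowI)
  fix H L assume "H \<in> assemblies \<sigma> P B" "L \<in> H"
  then have "\<sigma> L \<in> Pow B" "L \<in> P (\<sigma> L)" by (auto simp: assemblies_def)
  then show "L \<in> (\<Union>C\<in>Pow B. P C)" by (rule UN_I)
qed

lemma finite_structures:
  fixes P :: "'b set \<Rightarrow> 'c set"
  assumes "finite B" "\<And>C. finite C \<Longrightarrow> finite (P C)"
  shows "finite (\<Union>C\<in>Pow B. P C)"
proof (rule finite_UN_I)
  show "finite (Pow B)" using assms(1) by simp
  show "finite (P C)" if "C \<in> Pow B" for C
    using that finite_subset[OF _ assms(1)] by (intro assms(2)) simp
qed

lemma finite_assemblies: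
  assumes "finite B" "\<And>C. finite C \<Longrightarrow> finite (P C)"
  shows "finite (assemblies \<sigma> P B)"
  by (rule finite_subset[OF assemblies_subset_Pow]) (simp add: finite_structures[OF assms])

lemma finite_assembly:
  assumes "H \<in> assemblies \<sigma> P B" "finite B" "\<And>C. finite C \<Longrightarrow> finite (P C)"
  shows "finite H"
proof (rule finite_subset[OF _ finite_structures[OF assms(2,3)]])
  show "H \<subseteq> (\<Union>C\<in>Pow B. P C)"
    using assms(1) assemblies_subset_Pow by (rule PowD[OF subsetD[rotated]])
qed

lemma empty_in_assemblies_iff: "{} \<in> assemblies \<sigma> P B \<longleftrightarrow> B = {}"
  by (auto simp: assemblies_def disjoint_family_on_def)

lemma assemblies_empty: "assemblies \<sigma> P {} = {{}}"
  by (auto simp: assemblies_def disjoint_family_on_def)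

lemma subassembly:
  assumes "H \<in> assemblies \<sigma> P B" "K \<subseteq> H"
  shows "K \<in> assemblies \<sigma> P (\<Union> (\<sigma> ` K))"
proof -
  have "disjoint_family_on \<sigma> K"
    using assms by (intro disjoint_family_on_mono[OF assms(2)]) (simp add: assemblies_def)
  then show ?thesis
    using assms unfolding assemblies_def by (simp add: subset_iff)
qed

lemma assemblyD:
  assumes "H \<in> assemblies \<sigma> P B"
  shows "L \<in> H \<Longrightarrow> \<sigma> L \<noteq> {}" "L \<in> H \<Longrightarrow> L \<in> P (\<sigma> L)" "\<Union> (\<sigma> ` H) = B"
  using assms by (simp_all add: assemblies_def)

lemma assembly_unique:
  assumes "H \<in> assemblies \<sigma> P B" "L \<in> H" "L' \<in> H" "b \<in> \<sigma> L" "b \<in> \<sigma> L'"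
  shows "L = L'"
proof (rule ccontr)
  assume "L \<noteq> L'"
  moreover have "disjoint_family_on \<sigma> H" using assms(1) by (simp add: assemblies_def)
  ultimately have "\<sigma> L \<inter> \<sigma> L' = {}" using assms(2,3) by (simp add: disjoint_family_on_def)
  with assms(4,5) show False by blast
qed

lemma support_complement:
  assumes "H \<in> assemblies \<sigma> P B" "K \<subseteq> H"
  shows "\<Union> (\<sigma> ` (H - K)) = B - \<Union> (\<sigma> ` K)"
proof
  show "\<Union> (\<sigma> ` (H - K)) \<subseteq> B - \<Union> (\<sigma> ` K)"
  proof
    fix b assume "b \<in> \<Union> (\<sigma> ` (H - K))"
    then obtain L where L: "L \<in> H" "L \<notin> K" "b \<in> \<sigma> L" by blast
    have "b \<notin> \<sigma> L'" if "L' \<in> K" for L'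
      using assembly_unique[OF assms(1) L(1) _ L(3)] assms(2) that L(2) by blast
    then show "b \<in> B - \<Union> (\<sigma> ` K)" using assemblyD(3)[OF assms(1)] L by blast
  qed
  show "B - \<Union> (\<sigma> ` K) \<subseteq> \<Union> (\<sigma> ` (H - K))"
    using assemblyD(3)[OF assms(1)] by blast
qed

lemma assemblies_Un:
  assumes H: "H1 \<in> assemblies \<sigma> P B1" "H2 \<in> assemblies \<sigma> P B2" and B: "B1 \<inter> B2 = {}"
  shows "H1 \<union> H2 \<in> assemblies \<sigma> P (B1 \<union> B2)" "H1 \<inter> H2 = {}"
proof -
  have cross: "\<sigma> L \<inter> \<sigma> L' = {}" if "L \<in> H1" "L' \<in> H2" for L L'
  proof -
    have "\<sigma> L \<subseteq> B1" "\<sigma> L' \<subseteq> B2"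
      using that assemblyD(3)[OF H(1)] assemblyD(3)[OF H(2)] by auto
    with B show ?thesis by blast
  qed
  have disj: "disjoint_family_on \<sigma> H1" "disjoint_family_on \<sigma> H2"
    using H by (simp_all add: assemblies_def)
  have "disjoint_family_on \<sigma> (H1 \<union> H2)"
    unfolding disjoint_family_on_def
  proof (intro ballI impI)
    fix L L' assume "L \<in> H1 \<union> H2" "L' \<in> H1 \<union> H2" "L \<noteq> L'"
    then show "\<sigma> L \<inter> \<sigma> L' = {}"
      using cross[of L L'] cross[of L' L] disjoint_family_onD[OF disj(1), of L L']
        disjoint_family_onD[OF disj(2), of L L'] by (simp add: Int_commute) metis
  qed
  then show "H1 \<union> H2 \<in> assemblies \<sigma> P (B1 \<union> B2)"
    using H by (auto simp: assemblies_def)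
  show "H1 \<inter> H2 = {}"
  proof (rule ccontr)
    assume "H1 \<inter> H2 \<noteq> {}"
    then obtain L where "L \<in> H1" "L \<in> H2" by blast
    with cross[of L L] assemblyD(1)[OF H(1)] show False by simp
  qed
qed

text \<open>
  Splitting an assembly into two parts is the same as splitting its ground set and choosing an
  assembly on each part.
\<close>

lemma sum_split_assemblies:
  fixes g1 g2 :: "'c set \<Rightarrow> 'a::comm_ring_1"
  assumes B: "finite B" and P: "\<And>C. finite C \<Longrightarrow> finite (P C)"
  shows "(\<Sum>S\<in>Pow B. (\<Sum>H\<in>assemblies \<sigma> P S. g1 H) * (\<Sum>H\<in>assemblies \<sigma> P (B - S). g2 H)) =
    (\<Sum>H\<in>assemblies \<sigma> P B. \<Sum>K\<in>Pow H. g1 K * g2 (H - K))"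
proof -
  have fin: "finite (assemblies \<sigma> P S)" if "S \<subseteq> B" for S
    using that B by (intro finite_assemblies P) (auto intro: finite_subset)
  have "(\<Sum>S\<in>Pow B. (\<Sum>H\<in>assemblies \<sigma> P S. g1 H) * (\<Sum>H\<in>assemblies \<sigma> P (B - S). g2 H)) =
      (\<Sum>S\<in>Pow B. \<Sum>(H1, H2)\<in>assemblies \<sigma> P S \<times> assemblies \<sigma> P (B - S). g1 H1 * g2 H2)"
    by (simp add: sum_product sum.cartesian_product)
  also have "\<dots> = (\<Sum>(S, H1, H2)\<in>(SIGMA S:Pow B. assemblies \<sigma> P S \<times> assemblies \<sigma> P (B - S)). g1 H1 * g2 H2)"
    by (subst sum.Sigma) (use B fin in \<open>auto simp: split_def\<close>)
  \<comment> \<open>Both sides run over assemblies of \<open>B\<close> cut into two parts \<open>H1 = K\<close> and \<open>H2 = H - K\<close>.\<close>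
  also have "\<dots> = (\<Sum>(H, K)\<in>(SIGMA H:assemblies \<sigma> P B. Pow H). g1 K * g2 (H - K))"
  proof (rule sum.reindex_bij_witness[where i = "\<lambda>(H, K). (\<Union> (\<sigma> ` K), K, H - K)"
        and j = "\<lambda>(S, H1, H2). (H1 \<union> H2, H1)"], goal_cases)
    case (1 t)
    then obtain S H1 H2 where t: "t = (S, H1, H2)" "S \<subseteq> B" "H1 \<in> assemblies \<sigma> P S"
        "H2 \<in> assemblies \<sigma> P (B - S)" by auto
    then have "H1 \<inter> H2 = {}" "\<Union> (\<sigma> ` H1) = S"
      using assemblies_Un(2)[of H1 \<sigma> P S H2 "B - S"] by (auto simp: assemblies_def)
    with t(1) show ?case by auto
  next
    case (2 t)
    then obtain S H1 H2 where t: "t = (S, H1, H2)" "S \<subseteq> B" "H1 \<in> assemblies \<sigma> P S"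
        "H2 \<in> assemblies \<sigma> P (B - S)" by auto
    then have "H1 \<union> H2 \<in> assemblies \<sigma> P B"
      using assemblies_Un(1)[of H1 \<sigma> P S H2 "B - S"] by (simp add: Un_absorb1)
    with t(1) show ?case by auto
  next
    case (3 t)
    then show ?case by auto
  next
    case (4 t)
    then obtain H K where t: "t = (H, K)" "H \<in> assemblies \<sigma> P B" "K \<subseteq> H" by auto
    have "H - K \<in> assemblies \<sigma> P (B - \<Union> (\<sigma> ` K))"
      using subassembly[OF t(2), of "H - K"] support_complement[OF t(2,3)] by simp
    moreover have "\<Union> (\<sigma> ` K) \<subseteq> B" using t by (auto simp: assemblies_def)
    ultimately show ?case using t subassembly[OF t(2,3)] by simp
  next
    case (5 t)
    then obtain S H1 H2 where t: "t = (S, H1, H2)" "S \<subseteq> B" "H1 \<in> assemblies \<sigma> P S"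
        "H2 \<in> assemblies \<sigma> P (B - S)" by auto
    then have "H1 \<inter> H2 = {}"
      using assemblies_Un(2)[of H1 \<sigma> P S H2 "B - S"] by auto
    then have "H1 \<union> H2 - H1 = H2" by blast
    with t(1) show ?case by simp
  qed
  also have "\<dots> = (\<Sum>H\<in>assemblies \<sigma> P B. \<Sum>K\<in>Pow H. g1 K * g2 (H - K))"
    by (subst sum.Sigma) (use B fin finite_assembly[OF _ B P] in auto)
  finally show ?thesis .
qed

text \<open>
  These are the only assemblies that contribute to the differential of a linear form, which makes
  the case of a variable in the chain rule below an instance of its hypothesis.
\<close>

lemma singleton_assemblies:
  assumes B: "B \<noteq> {}" and \<sigma>: "\<And>L. L \<in> P B \<Longrightarrow> \<sigma> L = B"
  shows "{H \<in> assemblies \<sigma> P B. \<exists>L. H = {L}} = (\<lambda>L. {L}) ` P B"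
proof (intro equalityI subsetI)
  fix H assume "H \<in> {H \<in> assemblies \<sigma> P B. \<exists>L. H = {L}}"
  then obtain L where "H = {L}" "{L} \<in> assemblies \<sigma> P B" by blast
  moreover have "L \<in> P B"
    using assemblyD(2,3)[OF \<open>{L} \<in> assemblies \<sigma> P B\<close>] by simp
  ultimately show "H \<in> (\<lambda>L. {L}) ` P B" by simp
next
  fix H assume "H \<in> (\<lambda>L. {L}) ` P B"
  then show "H \<in> {H \<in> assemblies \<sigma> P B. \<exists>L. H = {L}}"
    using B by (auto simp: assemblies_def disjoint_family_on_def \<sigma>)
qed

text \<open>
  The chain rule for two maps, with the inner differentials already expanded into sums. As \<open>P C\<close>
  indexes the sum for the block \<open>C\<close>, multilinearity of the outer differential is part of the same
  induction. For products, both sides obey a Leibniz rule, on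
  the left over the subsets of \<open>B\<close> and on the right over the subsets of an assembly, and
  \<open>sum_split_assemblies\<close> matches the two.
\<close>

lemma polar_compose:
  fixes G :: "'a::comm_ring_1 pmap"
  assumes B: "finite B" and P: "\<And>C. finite C \<Longrightarrow> finite (P C)"
    and \<sigma>: "\<And>C L. L \<in> P C \<Longrightarrow> \<sigma> L = C"
    and G: "\<And>C l. finite C \<Longrightarrow> C \<noteq> {} \<Longrightarrow> polar x v C (G l) = (\<Sum>L\<in>P C. u L l)"
  shows "polar x v B (eval_in Const G p) = (\<Sum>H\<in>assemblies \<sigma> P B. polar (pmap_apply G x) u H p)"
  using B
proof (induction p arbitrary: B rule: mpoly_induct)
  case (Const c)
  have "(\<Sum>H\<in>assemblies \<sigma> P B. polar (pmap_apply G x) u H (Const c)) =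
      (\<Sum>H\<in>assemblies \<sigma> P B. if H = {} then c else 0)"
    by (intro sum.cong refl polar_Const finite_assembly[OF _ Const P])
  also have "\<dots> = (if B = {} then c else 0)"
    by (simp add: sum.delta' sum.delta finite_assemblies[OF Const P] empty_in_assemblies_iff)
  finally show ?case by (simp add: Const_hom.eval_in_Const polar_Const Const)
next
  case (Var l)
  show ?case
  proof (cases "B = {}")
    case True
    then show ?thesis
      by (simp add: assemblies_empty Const_hom.eval_in_Var polar_empty
        id_hom.eval_in_Var pmap_apply_def)
  next
    case False
    let ?A = "assemblies \<sigma> P B"
    have "(\<Sum>H\<in>?A. polar (pmap_apply G x) u H (Var l)) =
        (\<Sum>H\<in>?A. \<Sum>L\<in>H. if H = {L} then u L l else 0)"
    proof (rule sum.cong [OF refl])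
      fix H assume H: "H \<in> ?A"
      then have "H \<noteq> {}" using False by (auto simp: empty_in_assemblies_iff)
      then show "polar (pmap_apply G x) u H (Var l) = (\<Sum>L\<in>H. if H = {L} then u L l else 0)"
        by (simp add: polar_Var finite_assembly[OF H Var P])
    qed
    also have "\<dots> = (\<Sum>H\<in>{H \<in> ?A. \<exists>L. H = {L}}. \<Sum>L\<in>H. if H = {L} then u L l else 0)"
    proof (rule sum.mono_neutral_right)
      show "\<forall>H\<in>?A - {H \<in> ?A. \<exists>L. H = {L}}. (\<Sum>L\<in>H. if H = {L} then u L l else 0) = 0"
        by (intro ballI sum.neutral) simp
    qed (simp_all add: finite_assemblies[OF Var P])
    also have "\<dots> = (\<Sum>L\<in>P B. u L l)"
      using singleton_assemblies[OF False, of P \<sigma>] \<sigma> by (simp add: sum.reindex)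
    finally show ?thesis
      using G[OF Var False] by (simp add: Const_hom.eval_in_Var)
  qed
next
  case (add p q)
  then show ?case by (simp add: Const_hom.eval_in_add polar_add sum.distrib)
next
  case (mult p q)
  let ?y = "pmap_apply G x"
  have "polar x v B (eval_in Const G (p * q)) =
      (\<Sum>S\<in>Pow B. (\<Sum>H\<in>assemblies \<sigma> P S. polar ?y u H p) * (\<Sum>H\<in>assemblies \<sigma> P (B - S). polar ?y u H q))"
    unfolding Const_hom.eval_in_mult polar_mult[OF mult.prems]
  proof (intro sum.cong refl arg_cong2[where f = "(*)"] mult.IH)
    fix S assume "S \<in> Pow B"
    then show "finite S" using mult.prems by (auto intro: finite_subset)
  qed (use mult.prems in simp)
  also have "\<dots> = (\<Sum>H\<in>assemblies \<sigma> P B. \<Sum>K\<in>Pow H. polar ?y u K p * polar ?y u (H - K) q)"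
    by (rule sum_split_assemblies[OF mult.prems P])
  also have "\<dots> = (\<Sum>H\<in>assemblies \<sigma> P B. polar ?y u H (p * q))"
    by (intro sum.cong refl polar_mult[symmetric] finite_assembly[OF _ mult.prems P])
  finally show ?case .
qed


section \<open>Higher partitions as iterated assemblies\<close>

primrec hpart_support :: "'b hpart \<Rightarrow> 'b set" where
  "hpart_support (Block B) = B"
| "hpart_support (Family H) = \<Union> (fset (hpart_support |`| H))"

lemma hpart_support_hparts: "H \<in> hparts m B \<Longrightarrow> hpart_support H = B"
proof (induction m arbitrary: H B)
  case (Suc m)
  show ?case
  proof (cases m)
    case 0
    with Suc.prems show ?thesis by simp
  next
    case (Suc r)
    with Suc.prems obtain H' \<pi> h where H: "H = Family H'" "partition_on B \<pi>" "fset H' = h ` \<pi>"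
        and h: "\<And>C. C \<in> \<pi> \<Longrightarrow> h C \<in> hparts m C"
      by auto
    have "hpart_support (h C) = C" if "C \<in> \<pi>" for C
      using Suc.IH h that by blast
    then have "\<Union> (hpart_support ` h ` \<pi>) = \<Union> \<pi>" by simp
    with H(1,3) partition_onD1[OF H(2)] show ?thesis by simp
  qed
qed simp

text \<open>
  A family \<open>(H\<^sub>C)\<close> over the blocks of a partition is determined by the set of its members, because
  the support of \<open>H\<^sub>C\<close> is \<open>C\<close>. So the blocks need not be remembered, and different blocks never
  yield the same member.
\<close>

lemma hparts_Suc_Suc_eq_assemblies:
  "hparts (Suc (Suc r)) B =
    {Family H | H. fset H \<in> assemblies hpart_support (hparts (Suc r)) B}"
proof -
  have "(\<exists>\<pi> h. partition_on B \<pi> \<and> (\<forall>C\<in>\<pi>. h C \<in> hparts (Suc r) C) \<and> fset H = h ` \<pi>) \<longleftrightarrow>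
      fset H \<in> assemblies hpart_support (hparts (Suc r)) B" for H
  proof
    assume "\<exists>\<pi> h. partition_on B \<pi> \<and> (\<forall>C\<in>\<pi>. h C \<in> hparts (Suc r) C) \<and> fset H = h ` \<pi>"
    then obtain \<pi> h where \<pi>: "partition_on B \<pi>" and h: "\<And>C. C \<in> \<pi> \<Longrightarrow> h C \<in> hparts (Suc r) C"
        and H: "fset H = h ` \<pi>"
      by blast
    have supp: "hpart_support (h C) = C" if "C \<in> \<pi>" for C
      using hpart_support_hparts h that by blast
    have "disjoint_family_on hpart_support (h ` \<pi>)"
      unfolding disjoint_family_on_def
    proof (intro ballI impI)
      fix L L' assume "L \<in> h ` \<pi>" "L' \<in> h ` \<pi>" "L \<noteq> L'"
      then obtain C C' where "L = h C" "L' = h C'" "C \<in> \<pi>" "C' \<in> \<pi>" "C \<noteq> C'" by blast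
      with supp disjointD[OF partition_onD2[OF \<pi>]]
      show "hpart_support L \<inter> hpart_support L' = {}" by simp
    qed
    moreover have "\<Union> (hpart_support ` h ` \<pi>) = B"
      using supp partition_onD1[OF \<pi>] by simp
    moreover have "C \<noteq> {}" if "C \<in> \<pi>" for C
      using that partition_onD3[OF \<pi>] by blast
    ultimately show "fset H \<in> assemblies hpart_support (hparts (Suc r)) B"
      using h supp unfolding assemblies_def H by simp
  next
    assume H: "fset H \<in> assemblies hpart_support (hparts (Suc r)) B"
    \<comment> \<open>Distinct members have disjoint nonempty supports, so that a block determines its member.\<close>
    let ?\<pi> = "hpart_support ` fset H" and ?h = "inv_into (fset H) hpart_support"
    have inj: "inj_on hpart_support (fset H)"
    proof (rule inj_onI)
      fix L L' assume L: "L \<in> fset H" "L' \<in> fset H" "hpart_support L = hpart_support L'"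
      obtain b where "b \<in> hpart_support L" using assemblyD(1)[OF H L(1)] by blast
      with L show "L = L'" using assembly_unique[OF H L(1,2)] by simp
    qed
    have "partition_on B ?\<pi>"
    proof (rule partition_onI)
      show "\<Union> ?\<pi> = B" by (rule assemblyD(3)[OF H])
      fix C C' assume "C \<in> ?\<pi>" "C' \<in> ?\<pi>" "C \<noteq> C'"
      then obtain L L' where "L \<in> fset H" "L' \<in> fset H" "L \<noteq> L'"
          "C = hpart_support L" "C' = hpart_support L'" by blast
      then show "disjnt C C'" using assembly_unique[OF H] unfolding disjnt_iff by metis
    next
      show "{} \<notin> ?\<pi>" using assemblyD(1)[OF H] by force
    qed
    moreover have "\<forall>C\<in>?\<pi>. ?h C \<in> hparts (Suc r) C"
      using assemblyD(2)[OF H] inj by simp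
    moreover have "fset H = ?h ` ?\<pi>"
      using inj by simp
    ultimately show "\<exists>\<pi> h. partition_on B \<pi> \<and> (\<forall>C\<in>\<pi>. h C \<in> hparts (Suc r) C) \<and> fset H = h ` \<pi>"
      by blast
  qed
  then show ?thesis by simp
qed

lemma finite_hparts: "finite B \<Longrightarrow> finite (hparts m B)"
proof (induction m arbitrary: B)
  case (Suc m)
  show ?case
  proof (cases m)
    case (Suc r)
    have "finite (fset -` assemblies hpart_support (hparts m) B)"
      by (rule finite_vimageI[OF finite_assemblies[OF Suc.prems Suc.IH]])
        (simp_all add: inj_on_def fset_inject)
    then have "finite {H. fset H \<in> assemblies hpart_support (hparts m) B}"
      by (simp add: vimage_def)
    then have "finite (Family ` {H. fset H \<in> assemblies hpart_support (hparts m) B})"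
      by (rule finite_imageI)
    moreover have "Family ` {H. fset H \<in> assemblies hpart_support (hparts m) B} = hparts (Suc m) B"
      unfolding Suc hparts_Suc_Suc_eq_assemblies by blast
    ultimately show ?thesis by simp
  qed simp
qed simp

lemma sum_hparts_Suc_Suc:
  assumes "finite B"
  shows "(\<Sum>H\<in>hparts (Suc (Suc r)) B. g H) =
    (\<Sum>H\<in>assemblies hpart_support (hparts (Suc r)) B. g (Family (Abs_fset H)))"
proof -
  let ?A = "assemblies hpart_support (hparts (Suc r)) B"
  have fin: "fset (Abs_fset H) = H" if "H \<in> ?A" for H
    using finite_assembly[OF that assms finite_hparts] by (simp add: Abs_fset_inverse)
  have "hparts (Suc (Suc r)) B = (\<lambda>H. Family (Abs_fset H)) ` ?A"
  proof (intro equalityI subsetI)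
    fix H assume "H \<in> hparts (Suc (Suc r)) B"
    then obtain H' where "H = Family H'" "fset H' \<in> ?A"
      unfolding hparts_Suc_Suc_eq_assemblies by blast
    then show "H \<in> (\<lambda>H. Family (Abs_fset H)) ` ?A"
      by (intro image_eqI[where x = "fset H'"]) (simp_all add: fset_inverse)
  next
    fix H assume "H \<in> (\<lambda>H. Family (Abs_fset H)) ` ?A"
    then show "H \<in> hparts (Suc (Suc r)) B"
      unfolding hparts_Suc_Suc_eq_assemblies using fin by auto
  qed
  moreover have "inj_on (\<lambda>H. Family (Abs_fset H)) ?A"
    using fin by (intro inj_onI) (metis hpart.inject(2))
  ultimately show ?thesis by (simp add: sum.reindex)
qed

text \<open>
  Induction on the length of the chain: the chain rule for \<open>f\<^sub>r\<^sub>+\<^sub>1\<close> after the composite of the first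
  \<open>r\<close> maps, with the induction hypothesis expanding the inner differentials, sums over assemblies of
  \<open>r\<close>-fold partitions.
\<close>

theorem D_pmap_chain:
  fixes f :: "nat \<Rightarrow> 'a::comm_ring_1 pmap"
  assumes "finite B" "B \<noteq> {}"
  shows "D (pmap_chain f (Suc r)) x B v j = (\<Sum>H\<in>hparts (Suc r) B. D_hpart f x v (Suc r) H j)"
  using assms
proof (induction r arbitrary: B j)
  case 0
  show ?case by (simp add: D_eq_polar pmap_comp_def eval_in_Const_Var)
next
  case (Suc r)
  let ?G = "pmap_chain f (Suc r)" and ?F = "f (Suc (Suc r))"
  have "D (pmap_chain f (Suc (Suc r))) x B v j = polar x v B (eval_in Const ?G (?F j))"
    by (simp add: D_eq_polar pmap_comp_def)
  also have "\<dots> = (\<Sum>H\<in>assemblies hpart_support (hparts (Suc r)) B.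
      polar (pmap_apply ?G x) (D_hpart f x v (Suc r)) H (?F j))"
    by (rule polar_compose[OF Suc.prems(1) finite_hparts hpart_support_hparts Suc.IH[unfolded D_eq_polar]])
  also have "\<dots> = (\<Sum>H\<in>assemblies hpart_support (hparts (Suc r)) B.
      D_hpart f x v (Suc (Suc r)) (Family (Abs_fset H)) j)"
    by (intro sum.cong refl)
      (simp add: D_eq_polar Abs_fset_inverse finite_assembly[OF _ Suc.prems(1) finite_hparts]
        del: hparts.simps pmap_chain.simps)
  also have "\<dots> = (\<Sum>H\<in>hparts (Suc (Suc r)) B. D_hpart f x v (Suc (Suc r)) H j)"
    by (rule sum_hparts_Suc_Suc[symmetric, OF Suc.prems(1)])
  finally show ?case .
qed


section \<open>Profiles\<close>

lemma slots_empty: "slots {#} = {}"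
  by (auto simp: slots_def)

lemma slots_add_mset: "slots (add_mset y M) = insert (y, Suc (count M y)) (slots M)"
  by (auto simp: slots_def split: if_splits)

lemma fst_slots: "fst ` slots M = set_mset M"
  by (force simp: slots_def image_iff count_greater_zero_iff[symmetric] simp del: count_greater_zero_iff)

lemma finite_slots: "finite (slots M)"
  by (induction M) (simp_all add: slots_empty slots_add_mset)

lemma slots_eq_empty_iff: "slots M = {} \<longleftrightarrow> M = {#}"
  using fst_slots[of M] by (metis image_is_empty set_mset_eq_empty_iff)

lemma bij_slots_exists:
  assumes "finite I"
  shows "\<exists>g. inj_on g I \<and> g ` I = slots (image_mset p (mset_set I)) \<and> (\<forall>i\<in>I. fst (g i) = p i)"
  using assms
proof (induction I rule: finite_induct)
  case empty
  show ?case by (simp add: slots_empty)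
next
  case (insert i I)
  then obtain g where g: "inj_on g I" "g ` I = slots (image_mset p (mset_set I))"
      "\<forall>i\<in>I. fst (g i) = p i" by blast
  \<comment> \<open>The slot that appears when the multiplicity of \<open>p i\<close> grows by one.\<close>
  let ?new = "(p i, Suc (count (image_mset p (mset_set I)) (p i)))"
  let ?g = "g(i := ?new)"
  have new: "?new \<notin> slots (image_mset p (mset_set I))" by (simp add: slots_def)
  have img: "?g ` I = g ` I" using insert.hyps by (intro image_cong) auto
  have "inj_on ?g (insert i I)"
    using g(1,2) new insert.hyps img by (auto simp: inj_on_fun_updI)
  moreover have "?g ` insert i I = slots (image_mset p (mset_set (insert i I)))"
    using g(2) img insert.hyps by (simp add: slots_add_mset)
  moreover have "\<forall>i'\<in>insert i I. fst (?g i') = p i'" using g(3) by simp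
  ultimately show ?case by blast
qed

text \<open>
  A family that takes each value \<open>w' s\<close> as often as \<open>p\<close> takes the value \<open>s\<close> is a reindexing of the
  family of slots of the multiset of values of \<open>p\<close>.
\<close>

lemma D_eq_D_rep:
  assumes I: "finite I" and w: "\<And>i. i \<in> I \<Longrightarrow> w i = w' (p i)"
  shows "D h a I w = D_rep h a (image_mset p (mset_set I)) w'"
proof -
  obtain g where g: "inj_on g I" "g ` I = slots (image_mset p (mset_set I))"
      "\<And>i. i \<in> I \<Longrightarrow> fst (g i) = p i"
    using bij_slots_exists[OF I, of p] by blast
  have "polar a (\<lambda>(s, i). w' s) (g ` I) q = polar a w I q" for q
    by (rule polar_reindex[OF I g(1)]) (simp add: w g(3) split_def)
  then show ?thesis by (simp add: fun_eq_iff D_rep_def D_eq_polar g(2))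
qed

lemma hparts_Suc_Suc_memberD:
  assumes "Family H \<in> hparts (Suc (Suc r)) B" "L \<in> fset H"
  shows "L \<in> hparts (Suc r) (hpart_support L)" "hpart_support L \<subseteq> B" "hpart_support L \<noteq> {}"
proof -
  have H: "fset H \<in> assemblies hpart_support (hparts (Suc r)) B"
    using assms(1) unfolding hparts_Suc_Suc_eq_assemblies by simp
  show "L \<in> hparts (Suc r) (hpart_support L)" "hpart_support L \<noteq> {}"
    using assemblyD[OF H] assms(2) by simp_all
  show "hpart_support L \<subseteq> B" using assemblyD(3)[OF H] assms(2) by blast
qed

text \<open>
  On the slot set each direction depends on the first component of a slot only, so inductively the
  differential along \<open>L\<close> depends on the profile of \<open>L\<close> only. This is why equal terms can be collected
  in the second formula.
\<close>

lemma D_hpart_eq_D_hindex: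
  assumes "H \<in> hparts (Suc r) B" "finite B"
  shows "D_hpart f x (\<lambda>(s, i). v s) (Suc r) H = D_hindex f x v (Suc r) (profile H)"
  using assms
proof (induction r arbitrary: H B)
  case 0
  then show ?case by (simp add: D_eq_D_rep[of B _ v fst] split_def)
next
  case (Suc r)
  obtain H' where H: "H = Family H'" using Suc.prems(1) by auto
  have "D_hpart f x (\<lambda>(s, i). v s) (Suc r) L = D_hindex f x v (Suc r) (profile L)"
    if "L \<in> fset H'" for L
    using hparts_Suc_Suc_memberD[OF Suc.prems(1)[unfolded H] that] Suc.prems(2)
    by (intro Suc.IH[of L "hpart_support L"]) (auto intro: finite_subset simp del: hparts.simps)
  then show ?case
    by (simp add: H D_eq_D_rep[where p = profile and w' = "D_hindex f x v (Suc r)"] del: pmap_chain.simps)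
qed

lemma profile_in_hindices:
  assumes "H \<in> hparts (Suc r) B" "finite B" "B \<noteq> {}" "fst ` B \<subseteq> {1..k}"
  shows "profile H \<in> hindices (Suc r) k"
  using assms
proof (induction r arbitrary: H B)
  case 0
  then show ?case by (simp add: mset_set_empty_iff)
next
  case (Suc r)
  obtain H' where H: "H = Family H'" using Suc.prems(1) by auto
  have "fset H' \<in> assemblies hpart_support (hparts (Suc r)) B"
    using Suc.prems(1) unfolding H hparts_Suc_Suc_eq_assemblies by simp
  then have "fset H' \<noteq> {}" using Suc.prems(3) by (auto simp: assemblies_def)
  moreover have "profile L \<in> hindices (Suc r) k" if "L \<in> fset H'" for L
    using hparts_Suc_Suc_memberD[OF Suc.prems(1)[unfolded H] that] Suc.prems(2,4)
    by (intro Suc.IH[of L "hpart_support L"]) (auto intro: finite_subset simp del: hparts.simps)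
  ultimately show ?case by (auto simp: H mset_set_empty_iff)
qed

lemma sum_by_profile:
  fixes g :: "hindex \<Rightarrow> 'a::comm_ring_1"
  assumes "\<gamma> \<noteq> {#}" "set_mset \<gamma> \<subseteq> {1..k}"
  shows "finite {\<kappa> \<in> hindices (Suc r) k. Part_count (Suc r) \<gamma> \<kappa> \<noteq> 0}"
    and "(\<Sum>H\<in>hparts (Suc r) (slots \<gamma>). g (profile H)) =
      (\<Sum>\<kappa>\<in>{\<kappa> \<in> hindices (Suc r) k. Part_count (Suc r) \<gamma> \<kappa> \<noteq> 0}.
        of_nat (Part_count (Suc r) \<gamma> \<kappa>) * g \<kappa>)"
proof -
  let ?A = "hparts (Suc r) (slots \<gamma>)"
  have fin: "finite ?A" by (rule finite_hparts[OF finite_slots])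
  have in_hindices: "profile H \<in> hindices (Suc r) k" if "H \<in> ?A" for H
    using that assms finite_slots
    by (intro profile_in_hindices[of H r "slots \<gamma>"]) (simp_all add: slots_eq_empty_iff fst_slots)
  have K: "{\<kappa> \<in> hindices (Suc r) k. Part_count (Suc r) \<gamma> \<kappa> \<noteq> 0} = profile ` ?A"
    using fin in_hindices by (auto simp: Part_count_def simp del: hparts.simps hindices.simps)
  show "finite {\<kappa> \<in> hindices (Suc r) k. Part_count (Suc r) \<gamma> \<kappa> \<noteq> 0}"
    unfolding K using fin by (rule finite_imageI)
  have "(\<Sum>H\<in>?A. g (profile H)) = (\<Sum>\<kappa>\<in>profile ` ?A. \<Sum>H\<in>{H \<in> ?A. profile H = \<kappa>}. g (profile H))"
    by (rule sum.image_gen[OF fin])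
  also have "\<dots> = (\<Sum>\<kappa>\<in>profile ` ?A. of_nat (Part_count (Suc r) \<gamma> \<kappa>) * g \<kappa>)"
    by (intro sum.cong refl) (simp add: Part_count_def del: hparts.simps)
  finally show "(\<Sum>H\<in>?A. g (profile H)) =
      (\<Sum>\<kappa>\<in>{\<kappa> \<in> hindices (Suc r) k. Part_count (Suc r) \<gamma> \<kappa> \<noteq> 0}.
        of_nat (Part_count (Suc r) \<gamma> \<kappa>) * g \<kappa>)"
    unfolding K .
qed

theorem D_rep_pmap_chain:
  fixes f :: "nat \<Rightarrow> 'a::comm_ring_1 pmap"
  assumes "\<gamma> \<noteq> {#}" "set_mset \<gamma> \<subseteq> {1..k}"
  shows "D_rep (pmap_chain f (Suc r)) x \<gamma> v j =
    (\<Sum>\<kappa>\<in>{\<kappa> \<in> hindices (Suc r) k. Part_count (Suc r) \<gamma> \<kappa> \<noteq> 0}.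
      of_nat (Part_count (Suc r) \<gamma> \<kappa>) * D_hindex f x v (Suc r) \<kappa> j)"
proof -
  have "D_rep (pmap_chain f (Suc r)) x \<gamma> v j =
      (\<Sum>H\<in>hparts (Suc r) (slots \<gamma>). D_hpart f x (\<lambda>(s, i). v s) (Suc r) H j)"
    unfolding D_rep_def by (rule D_pmap_chain) (use assms in \<open>simp_all add: finite_slots slots_eq_empty_iff\<close>)
  also have "\<dots> = (\<Sum>H\<in>hparts (Suc r) (slots \<gamma>). D_hindex f x v (Suc r) (profile H) j)"
    by (intro sum.cong refl) (simp only: D_hpart_eq_D_hindex[OF _ finite_slots])
  also have "\<dots> = (\<Sum>\<kappa>\<in>{\<kappa> \<in> hindices (Suc r) k. Part_count (Suc r) \<gamma> \<kappa> \<noteq> 0}.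
      of_nat (Part_count (Suc r) \<gamma> \<kappa>) * D_hindex f x v (Suc r) \<kappa> j)"
    by (rule sum_by_profile(2)[OF assms])
  finally show ?thesis .
qed



theorem proposition29:
  fixes f :: "nat \<Rightarrow> 'a::comm_ring_1 pmap"
    and d :: "nat \<Rightarrow> nat"
    and x :: "nat \<Rightarrow> 'a"
    and v :: "nat \<Rightarrow> nat \<Rightarrow> 'a"
    and m k :: nat
  assumes "m \<ge> 1" and "k \<ge> 1"
    and "\<And>r. r \<in> {1..m} \<Longrightarrow> is_pmap (d (r - 1)) (d r) (f r)"
  shows "(\<forall>j<d m. D (pmap_chain f m) x {1..k} v j =
            (\<Sum>H \<in> hparts m {1..k}. D_hpart f x v m H j))
       \<and> (contains_rat TYPE('a) \<longrightarrow>
           (\<forall>\<gamma> :: nat multiset. set_mset \<gamma> \<subseteq> {1..k} \<and> \<gamma> \<noteq> {#} \<longrightarrow>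
             finite {\<kappa> \<in> hindices m k. Part_count m \<gamma> \<kappa> \<noteq> 0} \<and>
             (\<forall>j<d m. D_rep (pmap_chain f m) x \<gamma> v j =
               (\<Sum>\<kappa> \<in> {\<kappa> \<in> hindices m k. Part_count m \<gamma> \<kappa> \<noteq> 0}.
                  of_nat (Part_count m \<gamma> \<kappa>) * D_hindex f x v m \<kappa> j))))"
proof -
  obtain r where m: "m = Suc r" using \<open>m \<ge> 1\<close> by (cases m) auto
  have "{1..k} \<noteq> {}" using \<open>k \<ge> 1\<close> by simp
  then show ?thesis
    unfolding m
    by (intro conjI allI impI D_pmap_chain D_rep_pmap_chain sum_by_profile(1)) auto
qed

end
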